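(* Let $k, t \ge 2$ be integers. If $\ell$ is sufficiently large (that is, there is $\ell_0 = \ell_0(k,t)$ such that for all integers $\ell \ge \ell_0$), then $$ggr_{k,\ell}(S_t) = 2k(t-1)+1.$$
   Context: $S_t$ denotes the star with $t$ edges, i.e. $S_t = K_{1,t}$. All colorings are colorings of the edges of complete graphs. A colored complete graph has a nontrivial $G_k$-partition if there is a partition of its vertices into at least two (nonempty) parts such that at most $k$ colors in total appear on the edges between different parts. A colored complete graph is $k$-Gallai if every nontrivial induced subgraph (i.e. every induced subgraph on at least two vertices) has a nontrivial $G_k$-partition. For positive integers $k,\ell$ and a graph $H$, the generalized $(k,\ell)$ Gallai-Ramsey number $ggr_{k,\ell}(H)$ is the minimum $N$ such that every $k$-Gallai coloring of $K_n$ with $n \ge N$ using at most $\ell$ colors contains a monochromatic copy of $H$ (as a not necessarily induced subgraph). *)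

theory Defs
  imports Main "HOL-Library.Ramsey" "HOL-Library.Disjoint_Sets"
begin

text \<open>
  A finite simple graph is a pair of its vertex set and its set of edges, an edge being a
  two-element set of vertices. The edges of the complete graph on \<open>V\<close> are \<open>[V]\<^bsup>2\<^esup>\<close>, and a
  colouring is a function on edges; its values off \<open>[V]\<^bsup>2\<^esup>\<close> play no role. The vertex sets
  \<open>V\<close> below are meant to be finite, so that \<open>card\<close> has its usual meaning.
\<close>

type_synonym 'a sgraph = "'a set \<times> 'a set set"

definition star :: "nat \<Rightarrow> nat sgraph" where
  "star t = ({0..t}, {{0, i} | i. i \<in> {1..t}})"

definition cross_edges :: "'a set set \<Rightarrow> 'a set set" where
  "cross_edges P = {{u, v} | u v X Y. X \<in> P \<and> Y \<in> P \<and> X \<noteq> Y \<and> u \<in> X \<and> v \<in> Y}"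

definition has_G_partition :: "nat \<Rightarrow> ('a set \<Rightarrow> 'c) \<Rightarrow> 'a set \<Rightarrow> bool" where
  "has_G_partition k c V \<longleftrightarrow>
     (\<exists>P. partition_on V P \<and> 2 \<le> card P \<and> card (c ` cross_edges P) \<le> k)"

definition gallai_coloring :: "nat \<Rightarrow> ('a set \<Rightarrow> 'c) \<Rightarrow> 'a set \<Rightarrow> bool" where
  "gallai_coloring k c V \<longleftrightarrow> (\<forall>W\<subseteq>V. 2 \<le> card W \<longrightarrow> has_G_partition k c W)"

definition has_mono_copy :: "'b sgraph \<Rightarrow> ('a set \<Rightarrow> 'c) \<Rightarrow> 'a set \<Rightarrow> bool" where
  "has_mono_copy H c V \<longleftrightarrow>
     (\<exists>f a. inj_on f (fst H) \<and> f ` fst H \<subseteq> V \<and> (\<forall>e\<in>snd H. c (f ` e) = a))"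

text \<open>
  The complete graph \<open>K\<^sub>n\<close> has vertex set \<open>{..<n}\<close>. Natural numbers as colours are no
  restriction, since only finitely many colours are used.
\<close>

definition ggr :: "nat \<Rightarrow> nat \<Rightarrow> 'b sgraph \<Rightarrow> nat" where
  "ggr k l H = (LEAST N. \<forall>n\<ge>N. \<forall>c :: nat set \<Rightarrow> nat.
     gallai_coloring k c {..<n} \<and> card (c ` [{..<n}]\<^bsup>2\<^esup>) \<le> l \<longrightarrow> has_mono_copy H c {..<n})"

end

theory Submission
  imports Defs
begin

text \<open>
  Write \<open>s = t - 1\<close>. In a colouring without a monochromatic \<open>S\<^sub>t\<close>, a vertex of a part \<open>X\<close> of a
  \<open>G\<^sub>k\<close>-partition of \<open>V\<close> sends at most \<open>s\<close> edges of each of the at most \<open>k\<close> crossing colours to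
  \<open>V - X\<close>, so \<open>card (V - X) \<le> k * s\<close>; adding this up for two distinct parts gives
  \<open>card V \<le> 2 * k * s\<close>.

  Conversely, split \<open>2 * k * s\<close> vertices into two halves of size \<open>k * s\<close> and colour the edges
  between them with \<open>k\<close> colours, each forming an \<open>s\<close>-regular graph. Inside a half, every vertex
  \<open>i\<close> owns \<open>k\<close> private colours, used for the edges from \<open>i\<close> to the larger vertices of its half,
  each for at most \<open>s\<close> of them. An induced subgraph that meets both halves is partitioned by them;
  one inside a half is partitioned by splitting off its least vertex.
\<close>

section \<open>Monochromatic stars and the upper bound\<close>

text \<open>Lets both bounds count leaves instead of handling embeddings: the centre is the image of
  \<open>0\<close>, the leaves are the image of \<open>{1..t}\<close>.\<close>

lemma has_mono_copy_star_iff: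
  "has_mono_copy (star t) c V \<longleftrightarrow>
     (\<exists>v\<in>V. \<exists>a. \<exists>L\<subseteq>V - {v}. finite L \<and> card L = t \<and> (\<forall>u\<in>L. c {v, u} = a))"
proof
  assume "has_mono_copy (star t) c V"
  then obtain f a where inj: "inj_on f {0..t}" and sub: "f ` {0..t} \<subseteq> V"
    and edges: "\<forall>e\<in>{{0, i} | i. i \<in> {1..t}}. c (f ` e) = a"
    unfolding has_mono_copy_def star_def fst_conv snd_conv by blast
  have col: "c (f ` {0, i}) = a" if "i \<in> {1..t}" for i
    using edges that by blast
  have "inj_on f {1..t}"
    using inj by (rule inj_on_subset) auto
  then have "card (f ` {1..t}) = t"
    by (simp add: card_image)
  moreover have "f ` {1..t} \<subseteq> V - {f 0}"
    using inj_onD[OF inj, of _ 0] sub by fastforce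
  moreover have "\<forall>u\<in>f ` {1..t}. c {f 0, u} = a"
    using col by auto
  moreover have "f 0 \<in> V"
    using sub by auto
  ultimately show "\<exists>v\<in>V. \<exists>a. \<exists>L\<subseteq>V - {v}. finite L \<and> card L = t \<and> (\<forall>u\<in>L. c {v, u} = a)"
    by blast
next
  assume "\<exists>v\<in>V. \<exists>a. \<exists>L\<subseteq>V - {v}. finite L \<and> card L = t \<and> (\<forall>u\<in>L. c {v, u} = a)"
  then obtain v a L where v: "v \<in> V" and L: "L \<subseteq> V - {v}" "finite L" "card L = t"
    and col: "\<And>u. u \<in> L \<Longrightarrow> c {v, u} = a"
    by blast
  obtain g where g: "bij_betw g {1..t} L"
    using finite_same_card_bij[of "{1..t}" L] L by auto
  have gL: "g ` {1..t} = L"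
    using g by (rule bij_betw_imp_surj_on)
  let ?f = "g(0 := v)"
  have split: "{0..t} = insert 0 {1..t}"
    by auto
  have "inj_on ?f {1..t}"
    using bij_betw_imp_inj_on[OF g] gL L(1) by (intro inj_on_fun_updI) auto
  moreover have fL: "?f ` {1..t} = L"
    using gL by simp
  then have "?f 0 \<notin> ?f ` ({1..t} - {0})"
    using L(1) by auto
  ultimately have "inj_on ?f {0..t}"
    unfolding split inj_on_insert by blast
  moreover have "?f ` {0..t} \<subseteq> V"
    unfolding split image_insert fL using L(1) v by auto
  moreover have "c (?f ` {0, i}) = a" if "i \<in> {1..t}" for i
  proof -
    have "?f ` {0, i} = {v, g i}" "g i \<in> L"
      using gL that by auto
    then show ?thesis
      using col by metis
  qed
  then have "\<forall>e\<in>{{0, i} | i. i \<in> {1..t}}. c (?f ` e) = a"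
    by blast
  ultimately show "has_mono_copy (star t) c V"
    unfolding has_mono_copy_def star_def fst_conv snd_conv by blast
qed

lemma card_colour_class_less:
  assumes "finite V" and "\<not> has_mono_copy (star t) c V" and "v \<in> V" and "v \<notin> U" and "U \<subseteq> V"
  shows "card {u \<in> U. c {v, u} = a} < t"
proof (rule ccontr)
  assume "\<not> ?thesis"
  then obtain L where "L \<subseteq> {u \<in> U. c {v, u} = a}" "card L = t" "finite L"
    using obtain_subset_with_card_n[of t "{u \<in> U. c {v, u} = a}"] by (auto simp: not_less)
  then have "L \<subseteq> V - {v} \<and> finite L \<and> card L = t \<and> (\<forall>u\<in>L. c {v, u} = a)"
    using assms by auto
  then show False
    using assms(2,3) unfolding has_mono_copy_star_iff by blast
qed

lemma card_gallai_coloring_le: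
  assumes "finite V" and "2 \<le> card V" and "gallai_coloring k c V"
    and no_star: "\<not> has_mono_copy (star t) c V"
  shows "card V \<le> 2 * k * (t - 1)"
proof -
  obtain P where P: "partition_on V P" "2 \<le> card P" and k: "card (c ` cross_edges P) \<le> k"
    using assms unfolding gallai_coloring_def has_G_partition_def by blast
  have UP: "\<Union>P = V"
    using P by (simp add: partition_on_def)
  have "cross_edges P \<subseteq> Pow V"
    using UP unfolding cross_edges_def by auto
  then have fin: "finite (c ` cross_edges P)"
    using \<open>finite V\<close> by (meson finite_Pow_iff finite_imageI finite_subset)
  have outside: "card (V - X) \<le> k * (t - 1)" if X: "X \<in> P" for X
  proof -
    obtain v where v: "v \<in> X"
      using P(1) X by (metis partition_on_def ex_in_conv)
    \<comment> \<open>A vertex outside \<open>X\<close> lies in another part, so its edge to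
      \<open>v\<close> is a crossing edge.\<close>
    have "V - X \<subseteq> (\<Union>a\<in>c ` cross_edges P. {u \<in> V - X. c {v, u} = a})"
    proof
      fix u assume u: "u \<in> V - X"
      then obtain Y where "Y \<in> P" "u \<in> Y" "Y \<noteq> X"
        using UP by auto
      then have "{v, u} \<in> cross_edges P"
        using X v unfolding cross_edges_def by blast
      then show "u \<in> (\<Union>a\<in>c ` cross_edges P. {u \<in> V - X. c {v, u} = a})"
        using u by auto
    qed
    then have "card (V - X) \<le> card (\<Union>a\<in>c ` cross_edges P. {u \<in> V - X. c {v, u} = a})"
      using \<open>finite V\<close> fin by (intro card_mono finite_UN_I) auto
    also have "\<dots> \<le> (\<Sum>a\<in>c ` cross_edges P. card {u \<in> V - X. c {v, u} = a})"
      using fin by (rule card_UN_le)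
    also have "\<dots> \<le> of_nat (card (c ` cross_edges P)) * (t - 1)"
    proof (rule sum_bounded_above)
      fix a
      have "card {u \<in> V - X. c {v, u} = a} < t"
        using v X UP by (intro card_colour_class_less[OF \<open>finite V\<close> no_star]) auto
      then show "card {u \<in> V - X. c {v, u} = a} \<le> t - 1"
        by simp
    qed
    also have "\<dots> \<le> k * (t - 1)"
      using k by simp
    finally show ?thesis .
  qed
  obtain X Y where XY: "X \<in> P" "Y \<in> P" "X \<noteq> Y"
    using P(2) by (metis card_2_iff' obtain_subset_with_card_n subsetD)
  \<comment> \<open>Distinct parts are disjoint, so each vertex misses \<open>X\<close> or
    \<open>Y\<close>.\<close>
  then have "V \<subseteq> (V - X) \<union> (V - Y)"
    using P(1) by (auto simp: partition_on_def disjoint_def)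
  then have "card V \<le> card (V - X) + card (V - Y)"
    using \<open>finite V\<close> by (meson card_Un_le card_mono finite_Diff finite_UnI le_trans)
  then show ?thesis
    using outside[OF XY(1)] outside[OF XY(2)] by (simp add: mult.assoc)
qed

section \<open>The extremal colouring\<close>

text \<open>Cut the window into \<open>s\<close> blocks of length \<open>k\<close>: inside a block
  the residue of \<open>v + x\<close> determines \<open>x\<close>, so the block index is
  injective.\<close>

lemma card_residue_class_le:
  fixes k :: nat
  shows "card {x \<in> {p..<p + k * s}. (v + x) mod k = r} \<le> s"
proof -
  let ?R = "{x \<in> {p..<p + k * s}. (v + x) mod k = r}"
  have "inj_on (\<lambda>x. (x - p) div k) ?R"
  proof (rule inj_onI)
    fix x y
    assume x: "x \<in> ?R" and y: "y \<in> ?R" and eq: "(x - p) div k = (y - p) div k"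
    \<comment> \<open>Isolates the common summand \<open>v + p\<close>, which is then cancelled
      modulo \<open>k\<close>.\<close>
    have "((v + p) + (x - p)) mod k = ((v + p) + (y - p)) mod k"
      using x y by simp
    then have "(x - p) mod k = (y - p) mod k"
      unfolding nat_mod_eq_iff by (simp only: add.assoc add_left_cancel)
    then have "x - p = y - p"
      using eq by (metis div_mult_mod_eq)
    then show "x = y"
      using x y by auto
  qed
  moreover have "(\<lambda>x. (x - p) div k) ` ?R \<subseteq> {..<s}"
    by (auto simp: less_mult_imp_div_less mult.commute)
  ultimately show ?thesis
    using card_inj_on_le[of "\<lambda>x. (x - p) div k" ?R "{..<s}"] by simp
qed

lemma has_G_partition_two_parts:
  assumes "W = X \<union> Y" and "X \<inter> Y = {}" and "X \<noteq> {}" and "Y \<noteq> {}"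
    and "finite C" and "card C \<le> k" and "\<And>x y. x \<in> X \<Longrightarrow> y \<in> Y \<Longrightarrow> c {x, y} \<in> C"
  shows "has_G_partition k c W"
proof -
  have "partition_on W {X, Y}"
    using assms(1-4) by (auto simp: partition_on_def disjoint_def)
  moreover have "card {X, Y} = 2"
    using assms(2,3) by (auto simp: card_2_iff)
  moreover have "c ` cross_edges {X, Y} \<subseteq> C"
  proof -
    have "c {y, x} \<in> C" if "x \<in> X" "y \<in> Y" for x y
      using assms(7)[OF that] by (simp add: insert_commute)
    then show ?thesis
      using assms(7) by (auto simp: cross_edges_def)
  qed
  then have "card (c ` cross_edges {X, Y}) \<le> k"
    using assms(5,6) by (meson card_mono le_trans)
  ultimately show ?thesis
    unfolding has_G_partition_def by (metis order_refl)
qed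

text \<open>
  On the vertices \<open>{..<2 * m}\<close> with halves \<open>{..<m}\<close> and \<open>{m..<2 * m}\<close>: the colours below \<open>k\<close> are
  those of the edges between the halves, and \<open>{k + i * k..<k + i * k + k}\<close> are the private
  colours of the vertex \<open>i\<close>.
\<close>

definition split_coloring :: "nat \<Rightarrow> nat \<Rightarrow> nat set \<Rightarrow> nat" where
  "split_coloring k m e =
     (if Min e < m \<and> m \<le> Max e then 0 else k + Min e * k) + (Min e + Max e) mod k"

lemma split_coloring_less:
  "x < y \<Longrightarrow> split_coloring k m {x, y} =
     (if x < m \<and> m \<le> y then 0 else k + x * k) + (x + y) mod k"
  by (simp add: split_coloring_def)

text \<open>The hypothesis puts the endpoints in opposite halves, in either order; the sum is
  symmetric, so no minimum remains.\<close>

lemma split_coloring_across: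
  assumes "x < m \<longleftrightarrow> m \<le> y"
  shows "split_coloring k m {x, y} = (x + y) mod k"
proof (cases "x < y")
  case True
  then show ?thesis
    using assms by (auto simp: split_coloring_less)
next
  case False
  then have "y < x"
    using assms by auto
  then show ?thesis
    using assms split_coloring_less[of y x] by (auto simp: insert_commute add.commute)
qed

text \<open>\<open>V\<close> is arbitrary because \<open>{m..}\<close> serves as the upper
  half.\<close>

lemma gallai_split_coloring:
  assumes "0 < k"
  shows "gallai_coloring k (split_coloring k m) V"
  unfolding gallai_coloring_def
proof (intro allI impI)
  fix W :: "nat set"
  assume W: "2 \<le> card W"
  then have "finite W" "W \<noteq> {}"
    by (auto intro: card_ge_0_finite)
  show "has_G_partition k (split_coloring k m) W"
  proof (cases "W \<inter> {..<m} = {} \<or> W \<inter> {m..} = {}")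
    case False
    then show ?thesis
      using assms
      by (intro has_G_partition_two_parts[where X = "W \<inter> {..<m}" and Y = "W \<inter> {m..}" and C = "{..<k}"])
        (auto simp: split_coloring_across)
  next
    case True
    have "W - {Min W} \<noteq> {}"
      using W \<open>finite W\<close> \<open>W \<noteq> {}\<close>
      by (metis card.empty card_Diff_singleton Min_in diff_is_0_eq not_numeral_le_zero
          numeral_2_eq_2 One_nat_def Suc_n_not_le_n le_trans)
    moreover have "split_coloring k m {Min W, y} \<in> {k + Min W * k..<k + Min W * k + k}"
      if "y \<in> W - {Min W}" for y
    proof -
      have "Min W \<in> W" "Min W < y"
        using that \<open>finite W\<close> \<open>W \<noteq> {}\<close> Min_in[of W] Min_le[of W y] by (auto intro: le_neq_trans)
      moreover from this have "\<not> (Min W < m \<and> m \<le> y)"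
        using that True by auto
      ultimately show ?thesis
        using assms by (auto simp: split_coloring_less)
    qed
    ultimately show ?thesis
      using Min_in[OF \<open>finite W\<close> \<open>W \<noteq> {}\<close>]
      by (intro has_G_partition_two_parts[where X = "{Min W}" and Y = "W - {Min W}"
            and C = "{k + Min W * k..<k + Min W * k + k}"]) auto
  qed
qed

lemma card_split_coloring_le:
  assumes "0 < k"
  shows "card (split_coloring k m ` [{..<n}]\<^bsup>2\<^esup>) \<le> k + n * k"
proof -
  have "split_coloring k m e < k + n * k" if "e \<in> [{..<n}]\<^bsup>2\<^esup>" for e
  proof -
    have "finite e" "e \<noteq> {}" "e \<subseteq> {..<n}"
      using that by (auto simp: nsets_def)
    \<comment> \<open>The spare multiple of \<open>k\<close> absorbs the remainder modulo
      \<open>k\<close>.\<close>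
    then have "Suc (Min e) \<le> n"
      using Min_in[of e] unfolding Suc_le_eq by blast
    then have "Suc (Min e) * k \<le> n * k"
      by (rule mult_le_mono1)
    moreover have "(Min e + Max e) mod k < k"
      using assms by simp
    ultimately show ?thesis
      by (simp add: split_coloring_def)
  qed
  then have "split_coloring k m ` [{..<n}]\<^bsup>2\<^esup> \<subseteq> {..<k + n * k}"
    by auto
  then show ?thesis
    by (metis card_lessThan card_mono finite_lessThan)
qed

text \<open>If the colour of a star is a crossing colour, or is private to the centre, then all
  leaves lie in one half and share a residue, so there are at most \<open>t - 1\<close>. If it is
  private to another vertex, that vertex is the only possible leaf.\<close>

lemma split_coloring_no_star:
  assumes "0 < k" and "2 \<le> t" and m: "m = k * (t - 1)"
  shows "\<not> has_mono_copy (star t) (split_coloring k m) {..<2 * m}"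
proof
  assume "has_mono_copy (star t) (split_coloring k m) {..<2 * m}"
  then obtain v a L where v: "v < 2 * m" and L: "L \<subseteq> {..<2 * m} - {v}" "finite L" "card L = t"
    and col: "\<And>u. u \<in> L \<Longrightarrow> split_coloring k m {v, u} = a"
    unfolding has_mono_copy_star_iff by blast
  have window: False if "\<And>u. u \<in> L \<Longrightarrow> p \<le> u \<and> u < p + m \<and> (v + u) mod k = r" for p r
  proof -
    have "L \<subseteq> {x \<in> {p..<p + k * (t - 1)}. (v + x) mod k = r}"
      using that m by auto
    then have "card L \<le> card {x \<in> {p..<p + k * (t - 1)}. (v + x) mod k = r}"
      by (intro card_mono) auto
    also have "\<dots> \<le> t - 1"
      by (rule card_residue_class_le)
    finally show False
      using L(3) \<open>2 \<le> t\<close> by simp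
  qed
  have less: "(v + u) mod k < k" for u
    using assms(1) by simp
  have colour: "a = (if (v < m \<longleftrightarrow> m \<le> u) then 0 else k + min v u * k) + (v + u) mod k"
    if "u \<in> L" for u
  proof -
    have "u \<noteq> v"
      using that L by auto
    then consider "v < u" | "u < v"
      by linarith
    then show ?thesis
    proof cases
      case 1
      then show ?thesis
        using col[OF that] by (auto simp: split_coloring_less)
    next
      case 2
      then show ?thesis
        using col[OF that] split_coloring_less[OF 2, of k m]
        by (auto simp: insert_commute add.commute)
    qed
  qed
  show False
  proof (cases "a < k")
    case True
    then have "(v < m \<longleftrightarrow> m \<le> u) \<and> (v + u) mod k = a" if "u \<in> L" for u
      using colour[OF that] by (auto split: if_splits)
    then show False
      using L(1) by (intro window[of "if v < m then m else 0" a]) (auto split: if_splits)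
  next
    case False
    have same: "\<not> (v < m \<longleftrightarrow> m \<le> u)" and own: "min v u = a div k - 1"
      and res: "(v + u) mod k = a mod k" if "u \<in> L" for u
    proof -
      show "\<not> (v < m \<longleftrightarrow> m \<le> u)"
        using colour[OF that] less[of u] False by (auto split: if_splits)
      \<comment> \<open>The first \<open>k\<close> colours are the crossing ones, so dividing
        \<open>a\<close> by \<open>k\<close> yields the owner plus one.\<close>
      then have a: "a = (v + u) mod k + Suc (min v u) * k"
        using colour[OF that] by simp
      show "min v u = a div k - 1"
        unfolding a using assms(1) by (simp del: mult_Suc)
      show "(v + u) mod k = a mod k"
        unfolding a by (simp del: mult_Suc)
    qed
    show False
    proof (cases "v = a div k - 1")
      case True
      then show False
        using same res L(1) v
        by (intro window[of "if v < m then 0 else m" "a mod k"]) (auto split: if_splits)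
    next
      case False
      \<comment> \<open>The smaller endpoint of every edge of the star is the owner; as it is not
        \<open>v\<close>, it is the leaf.\<close>
      then have "L \<subseteq> {a div k - 1}"
        using own by (force simp: min_def split: if_splits)
      then have "card L \<le> 1"
        by (metis card_mono finite.emptyI finite_insert is_singletonI is_singleton_altdef)
      then show False
        using L(3) \<open>2 \<le> t\<close> by simp
    qed
  qed
qed

theorem proposition1:
  fixes k t :: nat
  assumes "2 \<le> k" and "2 \<le> t"
  shows "\<exists>l0. \<forall>l\<ge>l0. ggr k l (star t) = 2 * k * (t - 1) + 1"
proof -
  define m where "m = k * (t - 1)"
  have m: "2 * k * (t - 1) = 2 * m" "2 \<le> m"
    using assms mult_le_mono[of 2 k 1 "t - 1"] by (auto simp: m_def)
  \<comment> \<open>The threshold is the bound on the number of colours of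
    \<open>split_coloring\<close> on \<open>2 * m\<close> vertices.\<close>
  have "ggr k l (star t) = 2 * m + 1" if l: "k + 2 * m * k \<le> l" for l
    unfolding ggr_def
  proof (rule Least_equality)
    show "\<forall>n\<ge>2 * m + 1. \<forall>c :: nat set \<Rightarrow> nat. gallai_coloring k c {..<n} \<and>
        card (c ` [{..<n}]\<^bsup>2\<^esup>) \<le> l \<longrightarrow> has_mono_copy (star t) c {..<n}"
    proof (intro allI impI, rule ccontr)
      fix n and c :: "nat set \<Rightarrow> nat"
      assume "2 * m + 1 \<le> n" "gallai_coloring k c {..<n} \<and> card (c ` [{..<n}]\<^bsup>2\<^esup>) \<le> l"
        "\<not> has_mono_copy (star t) c {..<n}"
      then show False
        using card_gallai_coloring_le[of "{..<n}" k c t] m by auto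
    qed
  next
    fix N
    assume N: "\<forall>n\<ge>N. \<forall>c :: nat set \<Rightarrow> nat. gallai_coloring k c {..<n} \<and>
        card (c ` [{..<n}]\<^bsup>2\<^esup>) \<le> l \<longrightarrow> has_mono_copy (star t) c {..<n}"
    have "card (split_coloring k m ` [{..<2 * m}]\<^bsup>2\<^esup>) \<le> l"
      using card_split_coloring_le[of k m "2 * m"] assms l by linarith
    then have "\<not> N \<le> 2 * m"
      using N gallai_split_coloring[of k m] split_coloring_no_star[of k t m] assms m_def by auto
    then show "2 * m + 1 \<le> N"
      by simp
  qed
  then show ?thesis
    unfolding m(1) by blast
qed

end
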